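(* Let $p>2$, let $\mathcal{D}\subset\mathbb{H}$ be open, bounded and connected, and let $F\in\mathcal{C}(\mathbb{H})$ be bounded. For $\epsilon\in(0,1)$ let $u_\epsilon$ be the unique bounded continuous solution of $$u(q)=d_\epsilon(q)\Big(\frac13\mathcal{A}_3(u,\epsilon)(q)+\frac13\inf_{q'\in B_{\gamma_p\epsilon}(q)}\mathcal{A}_3(u,\epsilon)(q')+\frac13\sup_{q'\in B_{\gamma_p\epsilon}(q)}\mathcal{A}_3(u,\epsilon)(q')\Big)+(1-d_\epsilon(q))F(q),\quad q\in\mathbb{H}.$$ Assume that for every $\eta>0$ there exist $\delta>0$ and $\hat\epsilon\in(0,1)$ such that for all $\epsilon\in(0,\hat\epsilon)$ there holds $$|u_\epsilon(q_0')-u_\epsilon(q_0)|\le\eta\qquad\text{for all } q_0'\in\mathcal{D},\ q_0\in\partial\mathcal{D}\ \text{ satisfying }|q_0-q_0'|\le\delta.$$ Then the family $\{u_\epsilon\}_{\epsilon\to0}$ is equicontinuous in $\bar{\mathcal{D}}$.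
   Context: $\mathbb{H}=(\mathbb{R}^3,* )$ is the first Heisenberg group with $(x,y,z)*(x',y',z')=(x+x',y+y',z+z'+\frac12(xy'-yx'))$. The Korányi gauge is $|(x,y,z)|_K=((x^2+y^2)^2+16z^2)^{1/4}$, the metric is $d(q,q')=|q^{-1}*q'|_K$, $B_r(q)=\{q'\in\mathbb{H}: d(q,q')<r\}$, and $|\cdot|$ is the Euclidean norm. Define $\mathcal{A}_3(v,r)(q)=\frac{1}{|B_r(q)|}\int_{B_r(q)}v(p)\,dp$ (Lebesgue measure on $\mathbb{R}^3$), $d_\epsilon(q)=\frac1\epsilon\min\{\epsilon,\mathrm{dist}(q,\mathbb{H}\setminus\mathcal{D})\}$ with $\mathrm{dist}$ taken with respect to $d$, and $\gamma_p=\big(\frac{p-2}{\pi}\big)^{1/2}$. The family $\{u_\epsilon\}_{\epsilon\to0}$ is equicontinuous in $\bar{\mathcal{D}}$ means: for every $\eta>0$ there exist $\delta>0$ and $\hat\epsilon\in(0,1)$ such that $|u_\epsilon(q)-u_\epsilon(q')|\le\eta$ for all $\epsilon\in(0,\hat\epsilon)$ and all $q,q'\in\bar{\mathcal{D}}$ with $|q-q'|\le\delta$. *)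

theory Defs
  imports "HOL-Analysis.Analysis"
begin

type_synonym heis = "real ^ 3"

definition heis_mult :: "heis \<Rightarrow> heis \<Rightarrow> heis" where
  "heis_mult q q' =
     vector [q $ 1 + q' $ 1, q $ 2 + q' $ 2,
             q $ 3 + q' $ 3 + (1/2) * (q $ 1 * q' $ 2 - q $ 2 * q' $ 1)]"

definition heis_inv :: "heis \<Rightarrow> heis" where
  "heis_inv q = vector [- (q $ 1), - (q $ 2), - (q $ 3)]"

lemma heis_mult_assoc:
  "heis_mult (heis_mult a b) c = heis_mult a (heis_mult b c)"
  by (simp add: heis_mult_def vec_eq_iff forall_3 algebra_simps)

lemma heis_mult_zero [simp]: "heis_mult 0 q = q" "heis_mult q 0 = q"
  by (simp_all add: heis_mult_def vec_eq_iff forall_3)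

lemma heis_mult_inv [simp]:
  "heis_mult (heis_inv q) q = 0" "heis_mult q (heis_inv q) = 0"
  by (simp_all add: heis_mult_def heis_inv_def vec_eq_iff forall_3)

definition koranyi_gauge :: "heis \<Rightarrow> real" where
  "koranyi_gauge q = root 4 (((q $ 1)\<^sup>2 + (q $ 2)\<^sup>2)\<^sup>2 + 16 * (q $ 3)\<^sup>2)"

definition heis_dist :: "heis \<Rightarrow> heis \<Rightarrow> real" where
  "heis_dist q q' = koranyi_gauge (heis_mult (heis_inv q) q')"

text \<open>The library's \<open>ball\<close> and \<open>infdist\<close> on \<^typ>\<open>heis\<close> refer to the Euclidean metric;
  the next two are their counterparts for \<^const>\<open>heis_dist\<close>.\<close>

definition heis_ball :: "real \<Rightarrow> heis \<Rightarrow> heis set" where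
  "heis_ball r q = {q'. heis_dist q q' < r}"

definition heis_infdist :: "heis \<Rightarrow> heis set \<Rightarrow> real" where
  "heis_infdist q S = (INF q'\<in>S. heis_dist q q')"

definition avg3 :: "(heis \<Rightarrow> real) \<Rightarrow> real \<Rightarrow> heis \<Rightarrow> real" where
  "avg3 v r q = (1 / measure lborel (heis_ball r q)) * (LINT p:heis_ball r q|lborel. v p)"

definition bdry_cutoff :: "heis set \<Rightarrow> real \<Rightarrow> heis \<Rightarrow> real" where
  "bdry_cutoff D \<epsilon> q = (1 / \<epsilon>) * min \<epsilon> (heis_infdist q (UNIV - D))"

definition gamma_p :: "real \<Rightarrow> real" where
  "gamma_p p = sqrt ((p - 2) / pi)"

definition dpp_solution ::
  "real \<Rightarrow> heis set \<Rightarrow> (heis \<Rightarrow> real) \<Rightarrow> real \<Rightarrow> (heis \<Rightarrow> real) \<Rightarrow> bool" where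
  "dpp_solution p D F \<epsilon> u \<longleftrightarrow>
     bounded (range u) \<and> continuous_on UNIV u \<and>
     (\<forall>q. u q =
        bdry_cutoff D \<epsilon> q *
          ((1/3) * avg3 u \<epsilon> q
           + (1/3) * (INF q'\<in>heis_ball (gamma_p p * \<epsilon>) q. avg3 u \<epsilon> q')
           + (1/3) * (SUP q'\<in>heis_ball (gamma_p p * \<epsilon>) q. avg3 u \<epsilon> q'))
        + (1 - bdry_cutoff D \<epsilon> q) * F q)"

text \<open>Equicontinuity as \<open>\<epsilon> \<rightarrow> 0\<close>, with \<open>norm\<close> the Euclidean norm: only
  sufficiently small \<open>\<epsilon>\<close> are controlled, with a threshold that may depend on \<open>\<eta>\<close>.\<close>

definition equicontinuous_family :: "(real \<Rightarrow> heis \<Rightarrow> real) \<Rightarrow> heis set \<Rightarrow> bool" where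
  "equicontinuous_family u S \<longleftrightarrow>
     (\<forall>\<eta>>0. \<exists>\<delta>>0. \<exists>\<epsilon>'\<in>{0<..<1}. \<forall>\<epsilon>\<in>{0<..<\<epsilon>'}. \<forall>q\<in>S. \<forall>q'\<in>S.
        norm (q - q') \<le> \<delta> \<longrightarrow> \<bar>u \<epsilon> q - u \<epsilon> q'\<bar> \<le> \<eta>)"

end

theory Submission
  imports Defs
begin

text \<open>Left translations are affine maps of determinant 1 that preserve the metric, so they commute
  with the averaging operator. Given nearby \<open>q\<close> and \<open>q'\<close>, put \<open>w = q' * q\<^sup>-\<^sup>1\<close>; then
  \<open>x \<mapsto> u (w * x)\<close> solves the same equation as \<open>u\<close> away from the boundary, where the cut-off
  is 1. The difference of the two solutions satisfies a maximum principle: at an interior maximum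
  it is constant on a whole ball, and choosing the maximum point with the largest first coordinate
  gives a contradiction. Hence the difference is controlled by its values in a thin
  layer near the boundary, where the boundary estimate applies because \<open>w\<close> moves every point of the
  domain only a little.\<close>

section \<open>Left translations and the Euclidean size of Koranyi balls\<close>

lemma heis_ball_iff: "q' \<in> heis_ball r q \<longleftrightarrow> koranyi_gauge (heis_mult (heis_inv q) q') < r"
  by (simp add: heis_ball_def heis_dist_def)

lemma heis_inv_mult: "heis_inv (heis_mult a b) = heis_mult (heis_inv b) (heis_inv a)"
  by (simp add: heis_mult_def heis_inv_def vec_eq_iff forall_3 algebra_simps)

lemma heis_inv_mult_cancel [simp]:
  "heis_mult (heis_inv w) (heis_mult w q) = q" "heis_mult w (heis_mult (heis_inv w) q) = q"
  by (simp_all flip: heis_mult_assoc)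

lemma heis_ball_translate: "heis_mult w x \<in> heis_ball r (heis_mult w q) \<longleftrightarrow> x \<in> heis_ball r q"
  by (simp add: heis_ball_iff heis_inv_mult heis_mult_assoc)

lemma heis_ball_translate_image: "heis_ball r (heis_mult w q) = heis_mult w ` heis_ball r q"
proof -
  have "x \<in> heis_mult w ` heis_ball r q" if "x \<in> heis_ball r (heis_mult w q)" for x
    using that heis_ball_translate[of w "heis_mult (heis_inv w) x" r q]
    by (intro image_eqI[of _ _ "heis_mult (heis_inv w) x"]) simp_all
  then show ?thesis
    by (auto simp: heis_ball_translate)
qed

lemma koranyi_gauge_zero [simp]: "koranyi_gauge 0 = 0"
  by (simp add: koranyi_gauge_def)

lemma center_in_heis_ball [simp]: "r > 0 \<Longrightarrow> q \<in> heis_ball r q"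
  by (simp add: heis_ball_iff)

text \<open>The product is additive except for a term in the third coordinate that is bilinear in
  the factors. Moving one factor therefore moves the product by the same vector, up to a vertical
  correction.\<close>

lemma heis_mult_diff:
  "heis_mult a x - heis_mult b x = (a - b) + axis 3 (((a - b) $ 1 * x $ 2 - (a - b) $ 2 * x $ 1) / 2)"
  "heis_mult x a - heis_mult x b = (a - b) + axis 3 ((x $ 1 * (a - b) $ 2 - x $ 2 * (a - b) $ 1) / 2)"
  by (simp_all add: heis_mult_def vec_eq_iff forall_3 axis_def field_simps)

text \<open>The vertical correction is half the difference of two products, each at most
  \<open>norm (a - b) * norm x\<close>. The first bound controls the displacement caused by a left
  translation, the second the Euclidean size of balls.\<close>

lemma norm_heis_mult_diff_le:
  "norm (heis_mult a x - heis_mult b x) \<le> norm (a - b) * (1 + norm x)"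
  "norm (heis_mult x a - heis_mult x b) \<le> norm (a - b) * (1 + norm x)"
proof -
  let ?d = "a - b"
  have prod: "\<bar>?d $ i * x $ j\<bar> \<le> norm ?d * norm x" for i j
    unfolding abs_mult by (intro mult_mono component_le_norm_cart) auto
  have *: "norm (?d + axis 3 t) \<le> norm ?d * (1 + norm x)" if "\<bar>t\<bar> \<le> norm ?d * norm x" for t
    using norm_triangle_ineq[of ?d "axis 3 t"] norm_le_l1_cart[of "axis 3 t :: heis"] that
    by (simp add: sum_3 axis_def distrib_left)
  have half: "\<bar>(s - t) / 2\<bar> \<le> n" if "\<bar>s\<bar> \<le> n" "\<bar>t\<bar> \<le> n" for s t n :: real
    using that abs_triangle_ineq4[of s t] by simp
  show "norm (heis_mult a x - heis_mult b x) \<le> norm (a - b) * (1 + norm x)"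
    unfolding heis_mult_diff(1) by (intro * half prod)
  show "norm (heis_mult x a - heis_mult x b) \<le> norm (a - b) * (1 + norm x)"
    unfolding heis_mult_diff(2) by (intro * half) (use prod in \<open>metis mult.commute\<close>)+
qed

text \<open>The gauge gives the third coordinate weight two: it bounds \<open>x\<close> and
  \<open>y\<close> by \<open>r\<close>, but \<open>4 * \<bar>z\<bar>\<close> by
  \<open>r\<^sup>2\<close>. For \<open>r \<le> 1\<close> this is at most \<open>r\<close>, and the
  sum of the three coordinates gives the crude factor 3.\<close>

lemma norm_le_koranyi_gauge:
  assumes "koranyi_gauge h < r" "r \<le> 1"
  shows "norm h \<le> 3 * r"
proof -
  define x y z where "x = h $ 1" and "y = h $ 2" and "z = h $ 3"
  have g: "koranyi_gauge h = root 4 ((x\<^sup>2 + y\<^sup>2)\<^sup>2 + 16 * z\<^sup>2)"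
    by (simp add: koranyi_gauge_def x_def y_def z_def)
  have "0 \<le> koranyi_gauge h"
    unfolding g by (intro real_root_ge_zero) simp
  with assms have r: "0 < r" by simp
  have "(koranyi_gauge h)^4 < r^4"
    using assms \<open>0 \<le> koranyi_gauge h\<close> by (intro power_strict_mono) auto
  then have less: "(x\<^sup>2 + y\<^sup>2)\<^sup>2 + 16 * z\<^sup>2 < r^4"
    unfolding g by simp
  have r4: "r^4 = (r\<^sup>2)\<^sup>2" by (simp flip: power_mult)
  have "(x\<^sup>2 + y\<^sup>2)\<^sup>2 \<le> (r\<^sup>2)\<^sup>2"
    using less zero_le_power2[of z] unfolding r4 by linarith
  then have sq: "x\<^sup>2 + y\<^sup>2 \<le> r\<^sup>2"
    by (rule power2_le_imp_le) simp
  have "x\<^sup>2 \<le> r\<^sup>2" "y\<^sup>2 \<le> r\<^sup>2"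
    using sq zero_le_power2[of x] zero_le_power2[of y] by linarith+
  then have "\<bar>x\<bar> \<le> r" "\<bar>y\<bar> \<le> r"
    using r by (simp_all add: power2_le_iff_abs_le)
  moreover have "16 * z\<^sup>2 \<le> (r\<^sup>2)\<^sup>2"
    using less zero_le_power2[of "x\<^sup>2 + y\<^sup>2"] unfolding r4 by linarith
  then have "(4 * \<bar>z\<bar>)\<^sup>2 \<le> (r\<^sup>2)\<^sup>2"
    by (simp add: power_mult_distrib)
  then have "4 * \<bar>z\<bar> \<le> r\<^sup>2"
    by (rule power2_le_imp_le) simp
  moreover have "r\<^sup>2 \<le> r"
    using r assms(2) by (simp add: power2_eq_square mult_le_cancel_left1)
  ultimately have "\<bar>x\<bar> + \<bar>y\<bar> + \<bar>z\<bar> \<le> 3 * r"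
    using abs_ge_zero[of z] by linarith
  then show ?thesis
    using norm_le_l1_cart[of h] by (simp add: sum_3 x_def y_def z_def)
qed

lemma heis_ball_norm_le:
  assumes "q' \<in> heis_ball r q" "r \<le> 1"
  shows "norm (q' - q) \<le> 3 * r * (1 + norm q)"
proof -
  let ?h = "heis_mult (heis_inv q) q'"
  \<comment> \<open>Every point of the ball is \<open>q\<close> times an element \<open>?h\<close>
    of small gauge, so right factors \<open>?h\<close> and \<open>0\<close> are compared.\<close>
  have "norm (q' - q) = norm (heis_mult q ?h - heis_mult q 0)"
    by simp
  also have "\<dots> \<le> norm ?h * (1 + norm q)"
    using norm_heis_mult_diff_le(2)[of q ?h 0] by simp
  also have "\<dots> \<le> 3 * r * (1 + norm q)"
    using assms by (intro mult_right_mono norm_le_koranyi_gauge) (auto simp: heis_ball_iff)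
  finally show ?thesis .
qed

section \<open>Topology and measure of the balls, and translation invariance\<close>

lemma bounded_heis_ball:
  assumes "r \<le> 1" shows "bounded (heis_ball r q)"
proof -
  have "heis_ball r q \<subseteq> cball q (3 * r * (1 + norm q))"
    using heis_ball_norm_le[OF _ assms] by (auto simp: dist_norm norm_minus_commute)
  then show ?thesis
    using bounded_cball bounded_subset by blast
qed

lemma continuous_on_heis_mult [continuous_intros]:
  assumes "continuous_on S f" "continuous_on S g"
  shows "continuous_on S (\<lambda>x. heis_mult (f x) (g x))"
proof -
  have "continuous_on S (\<lambda>x. heis_mult (f x) (g x) $ i)" for i
    using exhaust_3[of i]
    by (elim disjE) ((simp add: heis_mult_def; intro continuous_intros assms; simp)+)
  then show ?thesis
    by (simp add: continuous_on_vec_lambda[of S "\<lambda>i x. heis_mult (f x) (g x) $ i", simplified])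
qed

lemma continuous_on_koranyi_gauge: "continuous_on UNIV koranyi_gauge"
  unfolding koranyi_gauge_def by (intro continuous_intros)

lemma open_heis_ball: "open (heis_ball r q)"
proof -
  have "continuous_on UNIV (\<lambda>x. koranyi_gauge (heis_mult (heis_inv q) x))"
    by (rule continuous_on_compose2[OF continuous_on_koranyi_gauge]) (auto intro: continuous_intros)
  then have "open {x. koranyi_gauge (heis_mult (heis_inv q) x) < r}"
    by (intro open_Collect_less continuous_intros)
  then show ?thesis
    by (simp add: heis_ball_def heis_dist_def)
qed

text \<open>\<open>measure\<close> is 0 on null sets and also on sets of infinite measure. Openness
  excludes the former, boundedness the latter.\<close>

lemma measure_heis_ball_pos:
  assumes "0 < r" "r \<le> 1"
  shows "0 < measure lborel (heis_ball r q)"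
proof -
  have "\<not> negligible (heis_ball r q)"
    using assms by (intro open_not_negligible open_heis_ball) (use center_in_heis_ball in blast)
  moreover have "heis_ball r q \<in> lmeasurable"
    using bounded_heis_ball[OF assms(2)] open_heis_ball by (intro lmeasurable_open)
  ultimately have "measure lebesgue (heis_ball r q) \<noteq> 0"
    by (simp add: negligible_iff_measure)
  then show ?thesis
    using open_heis_ball[of r q] by (simp add: measure_completion zero_less_measure_iff)
qed

text \<open>A left translation is a shear of determinant 1 followed by a Euclidean translation.
  Lebesgue measure is determined by its values on boxes, so these are the only sets to test.\<close>

lemma distr_lborel_heis_mult: "distr lborel borel (heis_mult w) = lborel"
proof (rule lborel_eqI[symmetric])
  fix l u :: heis
  assume lu: "\<And>b. b \<in> Basis \<Longrightarrow> l \<bullet> b \<le> u \<bullet> b"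
  \<comment> \<open>The preimage of a box under \<open>heis_mult w\<close> is its image under the
    inverse translation; \<open>f\<close> is the linear part of that inverse.\<close>
  define f :: "heis \<Rightarrow> heis" where "f = (\<lambda>x. heis_mult (heis_inv w) x - heis_inv w)"
  have f_eq: "f x = vector [x $ 1, x $ 2, x $ 3 + (w $ 2 * x $ 1 - w $ 1 * x $ 2) / 2]" for x
    by (simp add: f_def heis_mult_def heis_inv_def vec_eq_iff forall_3 field_simps)
  have lin: "linear f"
    by (rule linearI) (simp_all add: f_eq vec_eq_iff forall_3 field_simps)
  have det: "det (matrix f) = 1"
    by (simp add: det_3 matrix_def f_eq axis_def)
  have vim: "heis_mult w -` box l u = (+) (heis_inv w) ` f ` box l u"
  proof -
    have "x \<in> heis_mult (heis_inv w) ` box l u" if "heis_mult w x \<in> box l u" for x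
      using that by (intro image_eqI[of _ _ "heis_mult w x"]) simp_all
    then have "heis_mult w -` box l u = heis_mult (heis_inv w) ` box l u"
      by auto
    then show ?thesis
      by (simp add: image_image f_def)
  qed
  have meas: "heis_mult w \<in> borel_measurable borel"
    by (intro borel_measurable_continuous_onI continuous_intros)
  have "open (heis_mult w -` box l u)"
    by (intro open_vimage continuous_intros open_box)
  then have b: "heis_mult w -` box l u \<in> sets lborel"
    by simp
  have "measure lebesgue (heis_mult w -` box l u) = measure lebesgue (f ` box l u)"
    unfolding vim by (simp add: measure_translation)
  also have "\<dots> = measure lebesgue (box l u)"
    using measure_linear_image[OF lin, of "box l u"] det by simp
  finally have m: "measure lborel (heis_mult w -` box l u) = measure lborel (box l u)"
    using b by (simp add: measure_completion)
  \<comment> \<open>Finiteness is needed to lift the equality of \<open>measure\<close> to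
    \<open>emeasure\<close>, since \<open>measure\<close> does not tell infinity from 0.\<close>
  have "heis_mult w -` box l u \<in> lmeasurable"
    unfolding vim by (intro measurable_translation measurable_linear_image lin) simp
  then have fin: "emeasure lborel (heis_mult w -` box l u) \<noteq> \<infinity>"
    using b by (simp add: fmeasurable_def)
  have "emeasure (distr lborel borel (heis_mult w)) (box l u) = emeasure lborel (heis_mult w -` box l u)"
    using meas by (simp add: emeasure_distr)
  also have "\<dots> = emeasure lborel (box l u)"
    using fin m emeasure_lborel_box_finite[of l u] by (simp add: emeasure_eq_ennreal_measure less_top)
  finally show "emeasure (distr lborel borel (heis_mult w)) (box l u) = (\<Prod>b\<in>Basis. (u - l) \<bullet> b)"
    using lu by (simp add: emeasure_lborel_box)
qed simp

text \<open>Change of variables \<open>p \<mapsto> w * p\<close>: it preserves the measure and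
  carries the ball at \<open>q\<close> onto the ball at \<open>w * q\<close>.\<close>

lemma avg3_translate:
  assumes "continuous_on UNIV v"
  shows "avg3 (\<lambda>x. v (heis_mult w x)) r q = avg3 v r (heis_mult w q)"
proof -
  let ?B = "heis_ball r q" and ?B' = "heis_ball r (heis_mult w q)"
  have meas [measurable]: "heis_mult w \<in> borel_measurable borel" "v \<in> borel_measurable borel"
    by (intro borel_measurable_continuous_onI continuous_intros assms)+
  have [measurable]: "?B' \<in> sets borel"
    by (simp add: open_heis_ball)
  have vim: "heis_mult w -` ?B' = ?B"
    by (auto simp: heis_ball_translate)
  have "measure lborel ?B' = measure (distr lborel borel (heis_mult w)) ?B'"
    by (simp add: distr_lborel_heis_mult)
  also have "\<dots> = measure lborel ?B"
    by (simp add: measure_distr vim)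
  finally have m: "measure lborel ?B' = measure lborel ?B" .
  have "(LINT p:?B'|lborel. v p) = (LINT p:?B'|distr lborel borel (heis_mult w). v p)"
    by (simp add: distr_lborel_heis_mult)
  also have "\<dots> = (LINT p:?B|lborel. v (heis_mult w p))"
    unfolding set_lebesgue_integral_def
    by (subst integral_distr) (simp_all add: indicator_def heis_ball_translate)
  finally show ?thesis
    by (simp add: avg3_def m)
qed

section \<open>Averages over balls: linearity, bounds and the equality case\<close>

lemma set_integrable_heis_ball:
  fixes v :: "heis \<Rightarrow> real"
  assumes "continuous_on UNIV v" "r \<le> 1"
  shows "set_integrable lborel (heis_ball r q) v"
proof -
  have "set_integrable lborel (closure (heis_ball r q)) v"
    unfolding set_integrable_def
    by (intro borel_integrable_compact continuous_on_subset[OF assms(1)])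
      (simp_all add: bounded_heis_ball[OF assms(2)])
  then show ?thesis
    by (rule set_integrable_subset) (simp_all add: open_heis_ball closure_subset)
qed

lemma avg3_diff:
  assumes "continuous_on UNIV v" "continuous_on UNIV v'" "r \<le> 1"
  shows "avg3 (\<lambda>x. v x - v' x) r q = avg3 v r q - avg3 v' r q"
  using assms by (simp add: avg3_def set_integrable_heis_ball right_diff_distrib)

lemma avg3_const_diff:
  assumes "continuous_on UNIV v" "0 < r" "r \<le> 1"
  shows "avg3 (\<lambda>x. M - v x) r q = M - avg3 v r q"
proof -
  have "avg3 (\<lambda>_. M) r q = M"
    using measure_heis_ball_pos[OF assms(2,3), of q] open_heis_ball[of r q]
    by (simp add: avg3_def set_lebesgue_integral_def)
  then show ?thesis
    using avg3_diff[of "\<lambda>_. M" v r q] assms by simp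
qed

lemma avg3_nonneg:
  assumes "\<And>x. x \<in> heis_ball r q \<Longrightarrow> 0 \<le> v x"
  shows "0 \<le> avg3 v r q"
  unfolding avg3_def set_lebesgue_integral_def using assms
  by (intro mult_nonneg_nonneg integral_nonneg) (auto simp: indicator_def)

lemma avg3_le:
  assumes "continuous_on UNIV v" "0 < r" "r \<le> 1" "\<And>x. x \<in> heis_ball r q \<Longrightarrow> v x \<le> M"
  shows "avg3 v r q \<le> M"
  using avg3_nonneg[of r q "\<lambda>x. M - v x"] avg3_const_diff[of v r M q] assms by simp

lemma avg3_ge:
  assumes "continuous_on UNIV v" "0 < r" "r \<le> 1" "\<And>x. x \<in> heis_ball r q \<Longrightarrow> M \<le> v x"
  shows "M \<le> avg3 v r q"
proof -
  have "avg3 (\<lambda>x. 0 - v x) r q \<le> - M"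
    using assms by (intro avg3_le continuous_intros) auto
  then show ?thesis
    using avg3_const_diff[of v r 0 q] assms by simp
qed

text \<open>The function \<open>M - v\<close> is nonnegative on the ball and has average 0, so it
  vanishes almost everywhere there. Its zero set is closed, hence contains the whole open
  ball.\<close>

lemma avg3_eq_max:
  assumes v: "continuous_on UNIV v" and r: "0 < r" "r \<le> 1"
    and le: "\<And>x. x \<in> heis_ball r q \<Longrightarrow> v x \<le> M" and ge: "M \<le> avg3 v r q"
    and x: "x \<in> heis_ball r q"
  shows "v x = M"
proof -
  let ?B = "heis_ball r q" and ?g = "\<lambda>x. M - v x"
  have g: "continuous_on UNIV ?g"
    by (intro continuous_intros v)
  have "avg3 ?g r q = 0"
    using avg3_const_diff[OF v r, of M q] avg3_le[OF v r le, of q] ge by simp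
  then have "(LINT x:?B|lborel. ?g x) = 0"
    using measure_heis_ball_pos[OF r, of q] by (simp add: avg3_def)
  moreover have "integrable lborel (\<lambda>x. indicator ?B x *\<^sub>R ?g x)"
    using set_integrable_heis_ball[OF g r(2)] by (simp add: set_integrable_def)
  moreover have "0 \<le> indicator ?B x *\<^sub>R ?g x" for x
    using le by (simp add: indicator_def)
  ultimately have "AE x in lborel. indicator ?B x *\<^sub>R ?g x = 0"
    unfolding set_lebesgue_integral_def by (subst (asm) integral_nonneg_eq_0_iff_AE) auto
  then have "AE x\<in>?B in lborel. x \<in> {x. ?g x = 0}"
    by eventually_elim (simp add: indicator_def split: if_splits)
  then have "AE x\<in>?B in lebesgue. x \<in> {x. ?g x = 0}"
    by (rule AE_completion)
  moreover have "closed {x. ?g x = 0}"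
    by (intro closed_Collect_eq g continuous_intros)
  ultimately have "x \<in> {x. ?g x = 0}"
    using mem_closed_if_AE_lebesgue_open[OF open_heis_ball] x by blast
  then show ?thesis by simp
qed

section \<open>The averaging operator without cut-off, and its comparison principle\<close>

definition tug_mean :: "real \<Rightarrow> real \<Rightarrow> (heis \<Rightarrow> real) \<Rightarrow> heis \<Rightarrow> real" where
  "tug_mean r \<epsilon> v q =
     (1/3) * avg3 v \<epsilon> q
     + (1/3) * (INF q'\<in>heis_ball r q. avg3 v \<epsilon> q')
     + (1/3) * (SUP q'\<in>heis_ball r q. avg3 v \<epsilon> q')"

lemma tug_mean_translate:
  assumes "continuous_on UNIV v"
  shows "tug_mean r \<epsilon> (\<lambda>x. v (heis_mult w x)) q = tug_mean r \<epsilon> v (heis_mult w q)"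
  by (simp add: tug_mean_def avg3_translate[OF assms] heis_ball_translate_image image_image)

text \<open>Real-valued \<open>SUP\<close> and \<open>INF\<close> are only conditionally complete;
  these bounds license their use on averages.\<close>

lemma bounded_avg3:
  assumes "continuous_on UNIV v" "bounded (range v)" "0 < r" "r \<le> 1"
  shows "bdd_above ((\<lambda>q. avg3 v r q) ` S)" "bdd_below ((\<lambda>q. avg3 v r q) ` S)"
proof -
  obtain B where B: "\<And>x. \<bar>v x\<bar> \<le> B"
    using assms(2) by (auto simp: bounded_iff)
  show "bdd_above ((\<lambda>q. avg3 v r q) ` S)"
    using B by (intro bdd_aboveI2[of _ _ B] avg3_le assms) (simp add: abs_le_iff)
  show "bdd_below ((\<lambda>q. avg3 v r q) ` S)"
    using B by (intro bdd_belowI2[of _ "-B"] avg3_ge assms) (metis abs_le_iff minus_le_iff)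
qed

text \<open>Supremum and infimum are monotone and commute with adding a constant, so each of these
  terms contributes at most \<open>M / 3\<close>. The central average is kept exact, because the
  comparison principle exploits its equality case.\<close>

lemma tug_mean_diff_le:
  assumes v: "continuous_on UNIV v" "bounded (range v)"
    and v': "continuous_on UNIV v'" "bounded (range v')"
    and \<epsilon>: "0 < \<epsilon>" "\<epsilon> \<le> 1" and r: "0 < r"
    and le: "\<And>q' x. q' \<in> heis_ball r q \<Longrightarrow> x \<in> heis_ball \<epsilon> q' \<Longrightarrow> v x - v' x \<le> M"
  shows "tug_mean r \<epsilon> v q - tug_mean r \<epsilon> v' q \<le> avg3 (\<lambda>x. v x - v' x) \<epsilon> q / 3 + 2 * M / 3"
proof -
  let ?B = "heis_ball r q"
  have ne: "?B \<noteq> {}"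
    using center_in_heis_ball[OF r] by blast
  have le': "avg3 v \<epsilon> q' \<le> avg3 v' \<epsilon> q' + M" if "q' \<in> ?B" for q'
    using avg3_le[of "\<lambda>x. v x - v' x" \<epsilon> q' M] that le \<epsilon> v(1) v'(1)
    by (simp add: avg3_diff continuous_on_diff)
  have "(SUP q'\<in>?B. avg3 v \<epsilon> q') \<le> (SUP q'\<in>?B. avg3 v' \<epsilon> q') + M"
  proof (rule cSUP_least[OF ne])
    fix q' assume q': "q' \<in> ?B"
    show "avg3 v \<epsilon> q' \<le> (SUP q'\<in>?B. avg3 v' \<epsilon> q') + M"
      using le'[OF q'] cSUP_upper[OF q' bounded_avg3(1)[OF v' \<epsilon>]] by linarith
  qed
  moreover have "(INF q'\<in>?B. avg3 v \<epsilon> q') - M \<le> (INF q'\<in>?B. avg3 v' \<epsilon> q')"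
  proof (rule cINF_greatest[OF ne])
    fix q' assume q': "q' \<in> ?B"
    show "(INF q'\<in>?B. avg3 v \<epsilon> q') - M \<le> avg3 v' \<epsilon> q'"
      using le'[OF q'] cINF_lower[OF bounded_avg3(2)[OF v \<epsilon>] q'] by linarith
  qed
  ultimately show ?thesis
    using avg3_diff[OF v(1) v'(1) \<epsilon>(2), of q] unfolding tug_mean_def by linarith
qed

text \<open>\<open>U\<close> is where both equations hold and \<open>K - U\<close> is the boundary
  layer. By \<open>nest\<close>, the equations at points of \<open>U\<close> sample only values in
  \<open>K\<close>, so the maximum over \<open>K\<close> bounds everything they involve.\<close>

lemma tug_mean_comparison:
  assumes v: "continuous_on UNIV v" "bounded (range v)"
    and v': "continuous_on UNIV v'" "bounded (range v')"
    and \<epsilon>: "0 < \<epsilon>" "\<epsilon> \<le> 1" and r: "0 < r"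
    and K: "compact K" "U \<subseteq> K"
    and nest: "\<And>q q' x. q \<in> U \<Longrightarrow> q' \<in> heis_ball r q \<Longrightarrow> x \<in> heis_ball \<epsilon> q' \<Longrightarrow> x \<in> K"
    and sol: "\<And>q. q \<in> U \<Longrightarrow> v q = tug_mean r \<epsilon> v q"
    and sol': "\<And>q. q \<in> U \<Longrightarrow> v' q = tug_mean r \<epsilon> v' q"
    and layer: "\<And>q. q \<in> K - U \<Longrightarrow> v q - v' q \<le> m"
    and q: "q \<in> K"
  shows "v q - v' q \<le> m"
proof (rule ccontr)
  assume gt: "\<not> v q - v' q \<le> m"
  define f where "f = (\<lambda>x. v x - v' x)"
  have f: "continuous_on UNIV f"
    unfolding f_def by (intro continuous_intros v v')
  obtain x0 where x0: "x0 \<in> K" "\<And>x. x \<in> K \<Longrightarrow> f x \<le> f x0"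
    using continuous_attains_sup[OF K(1) _ continuous_on_subset[OF f]] q by blast
  define M where "M = f x0"
  have M: "f x \<le> M" if "x \<in> K" for x
    using x0 that by (simp add: M_def)
  have mM: "m < M"
    using gt M[OF q] by (simp add: f_def)
  have "closed {x. f x = M}"
    by (intro closed_Collect_eq f continuous_intros)
  then have "compact (K \<inter> {x. f x = M})"
    by (intro compact_Int_closed K)
  moreover have "x0 \<in> K \<inter> {x. f x = M}"
    using x0 by (simp add: M_def)
  moreover have "continuous_on S (\<lambda>x::heis. x $ 1)" for S
    by (intro continuous_intros)
  \<comment> \<open>The maximum may be attained at many points; they form a compact set, from which
    one with largest first coordinate is taken.\<close>
  ultimately obtain z where z: "z \<in> K" "f z = M"
    and zmax: "\<And>x. x \<in> K \<Longrightarrow> f x = M \<Longrightarrow> x $ 1 \<le> z $ 1"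
    using continuous_attains_sup[of "K \<inter> {x. f x = M}" "\<lambda>x. x $ 1"] by blast
  have zU: "z \<in> U"
    using layer[of z] z mM by (force simp: f_def)
  \<comment> \<open>As \<open>f z = M\<close>, the two terms \<open>M / 3\<close> cancel and the
    average over the ball must itself reach \<open>M\<close>.\<close>
  have "f z \<le> avg3 f \<epsilon> z / 3 + 2 * M / 3"
    unfolding f_def using sol[OF zU] sol'[OF zU] M[unfolded f_def] nest[OF zU]
    using tug_mean_diff_le[OF v v' \<epsilon> r, of z M] by simp
  then have avg: "M \<le> avg3 f \<epsilon> z"
    using z by simp
  have inK: "x \<in> K" if "x \<in> heis_ball \<epsilon> z" for x
    using nest[OF zU center_in_heis_ball[OF r] that] .
  \<comment> \<open>A horizontal step of gauge length \<open>\<epsilon> / 2\<close> stays in the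
    ball and raises the first coordinate by \<open>\<epsilon> / 2\<close>, against the choice of
    \<open>z\<close>.\<close>
  let ?y = "heis_mult z (axis 1 (\<epsilon> / 2))"
  have "koranyi_gauge (axis 1 (\<epsilon> / 2)) = root 4 ((\<epsilon> / 2) ^ 4)"
    by (simp add: koranyi_gauge_def axis_def flip: power_mult)
  also have "\<dots> = \<epsilon> / 2"
    using \<epsilon> by (intro real_root_power_cancel) auto
  finally have y: "?y \<in> heis_ball \<epsilon> z"
    using \<epsilon> by (simp add: heis_ball_iff)
  have "f ?y = M"
    using avg3_eq_max[OF f \<epsilon> M[OF inK] avg y] by simp
  then have "?y $ 1 \<le> z $ 1"
    using zmax inK[OF y] by blast
  then show False
    using \<epsilon> by (simp add: heis_mult_def axis_def)
qed

section \<open>The equation away from the boundary, and nearby boundary points\<close>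

lemma bdry_cutoff_eq_1:
  assumes "0 < \<epsilon>" "D \<noteq> UNIV" "heis_ball \<epsilon> q \<subseteq> D"
  shows "bdry_cutoff D \<epsilon> q = 1"
proof -
  \<comment> \<open>\<open>D \<noteq> UNIV\<close> makes the index set nonempty; an infimum over the
    empty set would carry no information.\<close>
  have "\<epsilon> \<le> heis_infdist q (UNIV - D)"
    unfolding heis_infdist_def
  proof (rule cINF_greatest)
    show "\<epsilon> \<le> heis_dist q x" if "x \<in> UNIV - D" for x
      using that assms(3) by (force simp: heis_ball_def)
  qed (use assms(2) in blast)
  then show ?thesis
    using assms(1) by (simp add: bdry_cutoff_def)
qed

lemma dpp_solution_eq_tug_mean:
  assumes "dpp_solution p D F \<epsilon> v" "0 < \<epsilon>" "D \<noteq> UNIV" "heis_ball \<epsilon> q \<subseteq> D"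
  shows "v q = tug_mean (gamma_p p * \<epsilon>) \<epsilon> v q"
  using assms(1) bdry_cutoff_eq_1[OF assms(2-4)]
  by (simp add: dpp_solution_def tug_mean_def)

text \<open>The segment from a point of \<open>D\<close> to a nearest point of the complement must
  cross the frontier. A point of the closure outside \<open>D\<close> is itself a frontier
  point.\<close>

lemma frontier_point_near:
  fixes D :: "heis set"
  assumes "open D" "D \<noteq> UNIV" "x \<in> closure D"
  obtains y where "y \<in> frontier D" "dist x y \<le> infdist x (- D)"
proof (cases "x \<in> D")
  case False
  then show ?thesis
    using that[of x] assms by (simp add: frontier_def interior_open)
next
  case True
  obtain z where z: "z \<in> - D" "infdist x (- D) = dist x z"
    using infdist_attains_inf[of "- D" x] assms by auto
  have "closed_segment x z \<inter> frontier D \<noteq> {}"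
    using True z by (intro connected_Int_frontier) auto
  then obtain y where y: "y \<in> closed_segment x z" "y \<in> frontier D" by blast
  then show ?thesis
    using that[of y] z dist_in_closed_segment[of y x z] by (simp add: dist_commute)
qed

section \<open>Equicontinuity from the boundary estimate\<close>

theorem theorem13p1:
  fixes p :: real and D :: "heis set" and F :: "heis \<Rightarrow> real"
    and u :: "real \<Rightarrow> heis \<Rightarrow> real"
  assumes "p > 2"
    and "open D" and "bounded D" and "connected D"
    and "continuous_on UNIV F" and "bounded (range F)"
    and "\<And>\<epsilon>. \<epsilon> \<in> {0<..<1} \<Longrightarrow> dpp_solution p D F \<epsilon> (u \<epsilon>)"
    and "\<forall>\<eta>>0. \<exists>\<delta>>0. \<exists>\<epsilon>'\<in>{0<..<1}. \<forall>\<epsilon>\<in>{0<..<\<epsilon>'}. \<forall>q0'\<in>D. \<forall>q0\<in>frontier D.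
           norm (q0 - q0') \<le> \<delta> \<longrightarrow> \<bar>u \<epsilon> q0' - u \<epsilon> q0\<bar> \<le> \<eta>"
  shows "equicontinuous_family u (closure D)"
  unfolding equicontinuous_family_def
proof (intro allI impI)
  fix \<eta> :: real assume "\<eta> > 0"
  \<comment> \<open>Depth in \<open>D\<close> is measured by Euclidean distance, like the boundary
    hypothesis and the conclusion.\<close>
  define s where "s = (\<lambda>x. infdist x (- D))"
  have D_UNIV: "D \<noteq> UNIV"
    using \<open>bounded D\<close> not_bounded_UNIV by blast
  have s_D: "x \<in> D" if "s x > 0" for x
    using that infdist_zero[of x "- D"] by (cases "x \<in> D") (auto simp: s_def)
  have s_lip: "s x \<le> s y + norm (x - y)" for x y
    using infdist_triangle[of x "- D" y] by (simp add: s_def dist_norm)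
  obtain R where R: "\<And>x. x \<in> closure D \<Longrightarrow> norm x \<le> R" "R > 0"
    using \<open>bounded D\<close> bounded_closure bounded_pos by metis
  have R_D: "norm x \<le> R" if "x \<in> D" for x
    using R(1) that closure_subset by blast
  \<comment> \<open>Tolerance \<open>\<eta> / 2\<close>, since two points will be compared through a
    common frontier point.\<close>
  obtain \<delta>0 \<epsilon>0 where \<delta>0: "\<delta>0 > 0" and \<epsilon>0: "\<epsilon>0 \<in> {0<..<1}"
    and bdry: "\<And>\<epsilon> x y. \<epsilon> \<in> {0<..<\<epsilon>0} \<Longrightarrow> x \<in> D \<Longrightarrow> y \<in> frontier D \<Longrightarrow> norm (y - x) \<le> \<delta>0
      \<Longrightarrow> \<bar>u \<epsilon> x - u \<epsilon> y\<bar> \<le> \<eta> / 2"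
    using assms(8)[rule_format, of "\<eta> / 2"] \<open>\<eta> > 0\<close> by (auto simp: Bex_def)
  have cont: "continuous_on UNIV (u \<epsilon>)" and bdd: "bounded (range (u \<epsilon>))" if "\<epsilon> \<in> {0<..<\<epsilon>0}" for \<epsilon>
    using assms(7)[of \<epsilon>] that \<epsilon>0 by (auto simp: dpp_solution_def)
  \<comment> \<open>Continuity extends the estimate from \<open>D\<close> to its closure; the strict
    inequality provides an open ball in which to approximate \<open>x\<close> by points of
    \<open>D\<close>.\<close>
  have bdry_closure: "\<bar>u \<epsilon> x - u \<epsilon> y\<bar> \<le> \<eta> / 2"
    if "\<epsilon> \<in> {0<..<\<epsilon>0}" "x \<in> closure D" "y \<in> frontier D" "norm (y - x) < \<delta>0" for \<epsilon> x y
  proof -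
    let ?C = "{x. \<bar>u \<epsilon> x - u \<epsilon> y\<bar> \<le> \<eta> / 2}"
    have "x \<in> closure (ball y \<delta>0 \<inter> D)"
      using open_Int_closure_subset[OF open_ball, of y \<delta>0 D] that by (auto simp: dist_norm)
    moreover have "closed ?C"
      by (intro closed_Collect_le continuous_intros cont that)
    moreover have "ball y \<delta>0 \<inter> D \<subseteq> ?C"
      using bdry that by (auto simp: dist_norm)
    ultimately show ?thesis
      using closure_minimal by blast
  qed
  \<comment> \<open>A point of depth below \<open>2 * a\<close> has a frontier point within
    \<open>2 * a\<close>, which lies within \<open>5 * a / 2\<close> of any point at distance at
    most \<open>a / 2\<close>; both distances are below \<open>\<delta>0 = 4 * a\<close>.\<close>
  define a where "a = \<delta>0 / 4"
  have a: "a > 0" "\<delta>0 = 4 * a"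
    using \<delta>0 by (simp_all add: a_def)
  have layer: "\<bar>u \<epsilon> x - u \<epsilon> y\<bar> \<le> \<eta>"
    if \<epsilon>: "\<epsilon> \<in> {0<..<\<epsilon>0}" and xy: "x \<in> closure D" "y \<in> closure D"
      and sx: "s x < 2 * a" and near: "norm (x - y) \<le> a / 2" for \<epsilon> x y
  proof -
    obtain z where z: "z \<in> frontier D" "norm (x - z) \<le> s x"
      using frontier_point_near[OF \<open>open D\<close> D_UNIV xy(1)] by (auto simp: dist_norm s_def)
    have "norm (z - x) < \<delta>0"
      using z(2) sx a by (simp add: norm_minus_commute)
    moreover have "norm (z - y) < \<delta>0"
      using norm_triangle_ineq[of "z - x" "x - y"] z(2) sx near a
      by (simp add: norm_minus_commute)
    ultimately have "\<bar>u \<epsilon> x - u \<epsilon> z\<bar> \<le> \<eta> / 2" "\<bar>u \<epsilon> y - u \<epsilon> z\<bar> \<le> \<eta> / 2"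
      using bdry_closure \<epsilon> xy z(1) by blast+
    then show ?thesis by linarith
  qed
  \<comment> \<open>One factor \<open>1 + R\<close> is lost in bounding \<open>norm w\<close> by
    \<open>norm (q' - q)\<close>, the other in bounding the displacement of a point of
    \<open>D\<close> by \<open>w\<close>.\<close>
  define \<delta> where "\<delta> = a / (2 * (1 + R)\<^sup>2)"
  have \<delta>: "\<delta> > 0" "\<delta> * (1 + R)\<^sup>2 = a / 2"
    using a R(2) by (simp_all add: \<delta>_def)
  have "\<delta> * 1 \<le> \<delta> * (1 + R)\<^sup>2"
    using \<delta>(1) R(2) by (intro mult_left_mono one_le_power) auto
  then have \<delta>_le: "\<delta> \<le> a / 2"
    using \<delta>(2) by simp
  define \<gamma> where "\<gamma> = gamma_p p"
  have \<gamma>: "\<gamma> > 0"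
    using \<open>p > 2\<close> by (simp add: \<gamma>_def gamma_p_def)
  \<comment> \<open>The second entry keeps the radii \<open>\<epsilon>\<close> and
    \<open>\<gamma> * \<epsilon>\<close> below 1; the third makes balls of these radii centred in
    \<open>D\<close> extend less than \<open>a / 2\<close> from their centres.\<close>
  define \<epsilon>1 where "\<epsilon>1 = min \<epsilon>0 (min (1 / (1 + \<gamma>)) (a / (12 * ((1 + \<gamma>) * (1 + R)))))"
  have \<epsilon>1: "\<epsilon>1 \<in> {0<..<1}"
    using \<epsilon>0 \<gamma> a R(2) by (auto simp: \<epsilon>1_def min_less_iff_disj)
  have "\<bar>u \<epsilon> q - u \<epsilon> q'\<bar> \<le> \<eta>"
    if "\<epsilon> \<in> {0<..<\<epsilon>1}" and q: "q \<in> closure D" "q' \<in> closure D" "norm (q - q') \<le> \<delta>" for \<epsilon> q q'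
  proof (cases "s q < 2 * a")
    case True
    then show ?thesis
      using layer[of \<epsilon> q q'] that \<delta>_le by (simp add: \<epsilon>1_def)
  next
    case False
    have \<epsilon>: "\<epsilon> \<in> {0<..<\<epsilon>0}" and \<epsilon>_small: "(1 + \<gamma>) * \<epsilon> < 1" "12 * ((1 + \<gamma>) * (1 + R)) * \<epsilon> < a"
      using that(1) \<gamma> R(2) by (simp_all add: \<epsilon>1_def pos_less_divide_eq mult.commute)
    have \<epsilon>_pos: "0 < \<epsilon>" and \<gamma>\<epsilon>: "0 < \<gamma> * \<epsilon>"
      using \<epsilon> \<gamma> by simp_all
    have \<epsilon>_le_1: "\<epsilon> \<le> 1"
      using \<epsilon> \<epsilon>0 by simp
    have step: "norm (y - x) < a / 2" if "x \<in> D" "y \<in> heis_ball t x" "t \<in> {\<epsilon>, \<gamma> * \<epsilon>}" for x y t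
    proof -
      have t: "0 < t" "t \<le> (1 + \<gamma>) * \<epsilon>"
        using that(3) \<epsilon>_pos \<gamma>\<epsilon> by (auto simp: distrib_right)
      have "norm (y - x) \<le> 3 * t * (1 + norm x)"
        using that(2) t \<epsilon>_small(1) by (intro heis_ball_norm_le) auto
      also have "\<dots> \<le> 3 * ((1 + \<gamma>) * \<epsilon>) * (1 + R)"
        using t R_D[OF that(1)] by (intro mult_mono) auto
      also have "\<dots> < a / 2"
        using \<epsilon>_small(2) a by (simp add: algebra_simps)
      finally show ?thesis .
    qed
    have s_step: "s x - a / 2 < s y" if "x \<in> D" "y \<in> heis_ball t x" "t \<in> {\<epsilon>, \<gamma> * \<epsilon>}" for x y t
      using step[OF that] s_lip[of x y] by (simp add: norm_minus_commute)
    have sol: "u \<epsilon> x = tug_mean (\<gamma> * \<epsilon>) \<epsilon> (u \<epsilon>) x" if "a \<le> s x" for x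
      unfolding \<gamma>_def
    proof (rule dpp_solution_eq_tug_mean[OF assms(7) \<epsilon>_pos D_UNIV])
      show "heis_ball \<epsilon> x \<subseteq> D"
        using s_step[of x _ \<epsilon>] s_D[of x] that a by (force intro!: s_D)
    qed (use \<epsilon> \<epsilon>0 in auto)
    \<comment> \<open>Left translation by \<open>w\<close> takes \<open>q\<close> to
      \<open>q'\<close>, so the function \<open>v\<close> below has
      \<open>v q = u \<epsilon> q'\<close>.\<close>
    define w where "w = heis_mult q' (heis_inv q)"
    have wq: "heis_mult w q = q'"
      by (simp add: w_def heis_mult_assoc)
    define v where "v = (\<lambda>x. u \<epsilon> (heis_mult w x))"
    have "norm w = norm (heis_mult q' (heis_inv q) - heis_mult q (heis_inv q))"
      by (simp add: w_def)
    also have "\<dots> \<le> norm (q' - q) * (1 + norm (heis_inv q))"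
      by (rule norm_heis_mult_diff_le)
    also have "heis_inv q = - q"
      by (simp add: heis_inv_def vec_eq_iff forall_3)
    also have "norm (q' - q) * (1 + norm (- q)) \<le> \<delta> * (1 + R)"
      using q R \<delta>(1) by (intro mult_mono) (auto simp: norm_minus_commute)
    finally have norm_w: "norm w \<le> \<delta> * (1 + R)" .
    have disp: "norm (x - heis_mult w x) \<le> a / 2" if "x \<in> D" for x
    proof -
      have "norm (x - heis_mult w x) \<le> norm w * (1 + norm x)"
        using norm_heis_mult_diff_le(1)[of 0 x w] by simp
      also have "\<dots> \<le> \<delta> * (1 + R) * (1 + R)"
        using norm_w R_D[OF that] \<delta>(1) R(2) by (intro mult_mono) auto
      finally show ?thesis
        using \<delta>(2) unfolding power2_eq_square mult.assoc by linarith
    qed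
    have s_disp: "s x - a / 2 \<le> s (heis_mult w x)" if "x \<in> D" for x
      using disp[OF that] s_lip[of x "heis_mult w x"] by simp
    \<comment> \<open>Translation costs at most \<open>a / 2\<close> of depth, so depth
      \<open>2 * a\<close> leaves more than the \<open>a\<close> required by
      \<open>sol\<close>.\<close>
    have sol_v: "v x = tug_mean (\<gamma> * \<epsilon>) \<epsilon> v x" if "2 * a \<le> s x" for x
    proof -
      have "a \<le> s (heis_mult w x)"
        using s_disp[of x] s_D[of x] that a by simp
      then show ?thesis
        unfolding v_def tug_mean_translate[OF cont[OF \<epsilon>]] by (rule sol)
    qed
    \<comment> \<open>The gap \<open>a\<close> between the two depths pays for two successive ball
      steps, of radii \<open>\<gamma> * \<epsilon>\<close> and \<open>\<epsilon>\<close>, each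
      costing less than \<open>a / 2\<close>. Points of \<open>?K - ?U\<close> are shallow enough
      for \<open>layer\<close>.\<close>
    let ?K = "{x. a \<le> s x}" and ?U = "{x. 2 * a \<le> s x}"
    have v_cont: "continuous_on UNIV v"
      unfolding v_def by (rule continuous_on_compose2[OF cont[OF \<epsilon>]]) (auto intro: continuous_intros)
    have v_bdd: "bounded (range v)"
      by (rule bounded_subset[OF bdd[OF \<epsilon>]]) (auto simp: v_def)
    have K_D: "?K \<subseteq> D"
      using a s_D by force
    have "closed ?K"
      unfolding s_def by (intro closed_Collect_le continuous_intros)
    then have K: "compact ?K"
      using bounded_subset[OF \<open>bounded D\<close> K_D] by (simp add: compact_eq_bounded_closed)
    have UK: "?U \<subseteq> ?K"
      using a by auto
    have nest: "z \<in> ?K" if "x \<in> ?U" "y \<in> heis_ball (\<gamma> * \<epsilon>) x" "z \<in> heis_ball \<epsilon> y" for x y z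
    proof -
      have "3 * a / 2 < s y"
        using s_step[of x y "\<gamma> * \<epsilon>"] s_D[of x] that a by simp
      then show ?thesis
        using s_step[of y z \<epsilon>] s_D[of y] that a by simp
    qed
    have layer': "\<bar>u \<epsilon> x - v x\<bar> \<le> \<eta>" if "x \<in> ?K - ?U" for x
    proof -
      have "x \<in> D"
        using that K_D by blast
      moreover have "heis_mult w x \<in> D"
        using s_disp[OF \<open>x \<in> D\<close>] that a by (intro s_D) auto
      ultimately show ?thesis
        using layer[OF \<epsilon>, of x "heis_mult w x"] disp[of x] that closure_subset[of D]
        by (auto simp: v_def)
    qed
    have qK: "q \<in> ?K"
      using False a by simp
    \<comment> \<open>The comparison principle is applied in both orders to obtain the absolute
      value.\<close>
    have "u \<epsilon> q - v q \<le> \<eta>"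
      by (rule tug_mean_comparison[OF cont[OF \<epsilon>] bdd[OF \<epsilon>] v_cont v_bdd \<epsilon>_pos \<epsilon>_le_1 \<gamma>\<epsilon> K UK
            nest _ _ _ qK])
        (use sol sol_v layer' UK in \<open>auto simp: abs_le_iff\<close>)
    moreover have "v q - u \<epsilon> q \<le> \<eta>"
      by (rule tug_mean_comparison[OF v_cont v_bdd cont[OF \<epsilon>] bdd[OF \<epsilon>] \<epsilon>_pos \<epsilon>_le_1 \<gamma>\<epsilon> K UK
            nest _ _ _ qK])
        (use sol sol_v layer' UK in \<open>auto simp: abs_le_iff\<close>)
    ultimately show ?thesis
      by (simp add: v_def wq abs_le_iff)
  qed
  then show "\<exists>\<delta>>0. \<exists>\<epsilon>'\<in>{0<..<1}. \<forall>\<epsilon>\<in>{0<..<\<epsilon>'}. \<forall>q\<in>closure D. \<forall>q'\<in>closure D.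
      norm (q - q') \<le> \<delta> \<longrightarrow> \<bar>u \<epsilon> q - u \<epsilon> q'\<bar> \<le> \<eta>"
    using \<delta>(1) \<epsilon>1 by blast
qed

end
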